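(* Let $n$, $m$ and $t$ be positive integers with $n>t>1$ and $m\le \left\lfloor \frac{n}{t+1}\right\rfloor$. Then $$p^{(t)}(n,m)=p^{(t-1)}(n,m)-p^{(t-1)}(n-t,m).$$
   Context: A partition of a positive integer $n$ is a finite sequence $\lambda=[\lambda_1,\ldots,\lambda_k]$ of positive integers with $\lambda_1\ge\cdots\ge\lambda_k$ and $\lambda_1+\cdots+\lambda_k=n$; we write $\lambda\vdash n$. For positive integers $n,m,t$, $p^{(t)}(n,m)$ denotes the number of partitions $\lambda\vdash n$ all of whose parts are at least $m$ and which satisfy $\lambda_1\ge t\cdot\lambda_2$. The one-part partition $[n]$ is considered to satisfy this condition, so it is counted whenever $n\ge m$. In particular, $p^{(t)}(n,m)=0$ if $n<m$, and $p^{(1)}(n,m)$ is the number of partitions of $n$ with all parts at least $m$. *)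

theory Defs
  imports Main
begin

definition is_partition :: "nat list \<Rightarrow> nat \<Rightarrow> bool" (infix "\<turnstile>" 50) where
  "xs \<turnstile> n \<longleftrightarrow> sorted_wrt (\<ge>) xs \<and> (\<forall>x\<in>set xs. x > 0) \<and> sum_list xs = n"

text \<open>The list index starts at 0, so the largest and second largest parts are the entries
  0 and 1. One-part partitions satisfy the ratio condition vacuously.\<close>

definition ratio_partitions :: "nat \<Rightarrow> nat \<Rightarrow> nat \<Rightarrow> nat list set" where
  "ratio_partitions t n m =
     {xs. xs \<turnstile> n \<and> (\<forall>x\<in>set xs. x \<ge> m) \<and> (length xs \<ge> 2 \<longrightarrow> xs ! 0 \<ge> t * xs ! 1)}"

definition part_count :: "nat \<Rightarrow> nat \<Rightarrow> nat \<Rightarrow> nat" where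
  "part_count t n m = card (ratio_partitions t n m)"

lemma finite_ratio_partitions: "finite (ratio_partitions t n m)"
proof (rule finite_subset)
  have "length xs \<le> sum_list xs" if "\<forall>x\<in>set xs. x > 0" for xs :: "nat list"
    using that by (induction xs) auto
  then show "ratio_partitions t n m \<subseteq> {xs. set xs \<subseteq> {..n} \<and> length xs \<le> n}"
    by (auto simp: ratio_partitions_def is_partition_def member_le_sum_list)
  show "finite {xs. set xs \<subseteq> {..n} \<and> length xs \<le> n}"
    by (rule finite_lists_length_le) simp
qed

end

theory Submission
  imports Defs
begin

text \<open>
  The partitions counted by $p^{(t-1)}(n,m)$ split into two classes. Duplicating the second part,
  $[\lambda_1,\lambda_2,\lambda_3,\ldots] \mapsto
   [\lambda_1-\lambda_2,\lambda_2,\lambda_2,\lambda_3,\ldots]$,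
  injects the partitions counted by $p^{(t)}(n,m)$ onto those that are $[n]$ or have equal second
  and third parts. The map $[\lambda_1,\lambda_2,\lambda_3,\ldots] \mapsto
   [\lambda_1+t-1,\lambda_2+1,\lambda_3,\ldots]$ together with $[n-t] \mapsto [n-m,m]$ injects those
  counted by $p^{(t-1)}(n-t,m)$ onto the remaining ones. The bound on $m$ makes $[n-m,m]$ admissible.
\<close>

fun duplicate_second :: "nat list \<Rightarrow> nat list" where
  "duplicate_second (a # b # xs) = (a - b) # b # b # xs"
| "duplicate_second xs = xs"

text \<open>Here \<open>u\<close> stands for t - 1. On the one-part input a = n - t, so
  \<open>a + Suc u - m\<close> is n - m.\<close>

fun raise_top :: "nat \<Rightarrow> nat \<Rightarrow> nat list \<Rightarrow> nat list" where
  "raise_top m u (a # b # xs) = (a + u) # Suc b # xs"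
| "raise_top m u [a] = [a + Suc u - m, m]"
| "raise_top m u [] = []"

lemma Nil_in_ratio_partitions: "[] \<in> ratio_partitions t n m \<longleftrightarrow> n = 0"
  by (auto simp: ratio_partitions_def is_partition_def)

lemma single_in_ratio_partitions:
  "[a] \<in> ratio_partitions t n m \<longleftrightarrow> a = n \<and> 0 < n \<and> m \<le> n"
  by (auto simp: ratio_partitions_def is_partition_def)

text \<open>For positive \<open>t\<close> the ratio condition already forces
  \<open>b \<le> a\<close>, so the order of the first two parts needs no separate clause.\<close>

lemma Cons_Cons_in_ratio_partitions:
  assumes "0 < t"
  shows "a # b # xs \<in> ratio_partitions t n m \<longleftrightarrow>
    t * b \<le> a \<and> 0 < b \<and> m \<le> b \<and> (\<forall>x\<in>set xs. x \<le> b \<and> 0 < x \<and> m \<le> x) \<and>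
    sorted_wrt (\<ge>) xs \<and> a + b + sum_list xs = n"
    (is "_ \<longleftrightarrow> ?rhs")
proof -
  have "b \<le> a" if "t * b \<le> a"
    using that assms by (cases t) auto
  then show ?thesis
    by (fastforce simp: ratio_partitions_def is_partition_def)
qed

lemmas in_ratio_partitions =
  Nil_in_ratio_partitions single_in_ratio_partitions Cons_Cons_in_ratio_partitions

lemma list_cases_two:
  obtains "xs = []" | a where "xs = [a]" | a b ys where "xs = a # b # ys"
  by (metis neq_Nil_conv)

text \<open>From (u + 1) * b \<le> a follows u * b \<le> a - b.\<close>

lemma duplicate_second_in_ratio_partitions:
  assumes "0 < u" and "xs \<in> ratio_partitions (Suc u) n m"
  shows "duplicate_second xs \<in> ratio_partitions u n m"
  using assms by (cases xs rule: list_cases_two) (auto simp: in_ratio_partitions)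

lemma inj_on_duplicate_second: "inj_on duplicate_second (ratio_partitions (Suc u) n m)"
proof (rule inj_onI)
  fix xs ys
  assume "xs \<in> ratio_partitions (Suc u) n m" "ys \<in> ratio_partitions (Suc u) n m"
    and "duplicate_second xs = duplicate_second ys"
  then show "xs = ys"
    by (cases xs rule: list_cases_two; cases ys rule: list_cases_two)
      (auto simp: in_ratio_partitions)
qed

text \<open>From u * b \<le> a follows u * (b + 1) \<le> a + u. For [n - m, m] the bound on
  \<open>m\<close> gives u * m \<le> n - m.\<close>

lemma raise_top_in_ratio_partitions:
  assumes "0 < u" "0 < m" "Suc (Suc u) * m \<le> n" "Suc u < n"
    and "xs \<in> ratio_partitions u (n - Suc u) m"
  shows "raise_top m u xs \<in> ratio_partitions u n m"
  using assms by (cases xs rule: list_cases_two) (auto simp: in_ratio_partitions)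

text \<open>The one-part input cannot collide with a longer one: its image has second part
  \<open>m\<close>, while a raised second part exceeds \<open>m\<close>.\<close>

lemma inj_on_raise_top:
  assumes "0 < u" "0 < m" "Suc u < n"
  shows "inj_on (raise_top m u) (ratio_partitions u (n - Suc u) m)"
proof (rule inj_onI)
  fix xs ys
  assume "xs \<in> ratio_partitions u (n - Suc u) m" "ys \<in> ratio_partitions u (n - Suc u) m"
    and "raise_top m u xs = raise_top m u ys"
  then show "xs = ys"
    using assms
    by (cases xs rule: list_cases_two; cases ys rule: list_cases_two)
      (auto simp: in_ratio_partitions)
qed

text \<open>A raised second part is strictly larger than any third part, whereas a duplicated one
  equals it; [n] is no raised list, as those have at least two parts.\<close>

lemma duplicate_second_raise_top_disjoint:
  assumes "0 < u" "Suc u < n"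
  shows "duplicate_second ` ratio_partitions (Suc u) n m \<inter>
    raise_top m u ` ratio_partitions u (n - Suc u) m = {}"
proof -
  have "duplicate_second xs \<noteq> raise_top m u ys"
    if "xs \<in> ratio_partitions (Suc u) n m" "ys \<in> ratio_partitions u (n - Suc u) m" for xs ys
    using that assms
    by (cases xs rule: list_cases_two; cases ys rule: list_cases_two)
      (auto simp: in_ratio_partitions)
  then show ?thesis by blast
qed

lemma ratio_partitions_subset_images:
  assumes "0 < u" "0 < m" "Suc (Suc u) * m \<le> n" "Suc u < n"
  shows "ratio_partitions u n m \<subseteq> duplicate_second ` ratio_partitions (Suc u) n m \<union>
    raise_top m u ` ratio_partitions u (n - Suc u) m"
proof
  fix xs assume xs: "xs \<in> ratio_partitions u n m"
  show "xs \<in> duplicate_second ` ratio_partitions (Suc u) n m \<union>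
    raise_top m u ` ratio_partitions u (n - Suc u) m"
  proof (cases xs rule: list_cases_two)
    case 1
    then show ?thesis using xs assms by (simp add: in_ratio_partitions)
  next
    case (2 a)
    then have "xs = duplicate_second [a]" "[a] \<in> ratio_partitions (Suc u) n m"
      using xs by (simp_all add: in_ratio_partitions)
    then show ?thesis by blast
  next
    case (3 a b ys)
    \<comment> \<open>This puts [n - t] among the partitions with parts at least \<open>m\<close>,
      as the preimage of [n - m, m].\<close>
    have step: "Suc u + m \<le> n"
    proof -
      have "Suc u * 1 \<le> Suc u * m" using assms(2) by (intro mult_le_mono) auto
      then show ?thesis using assms(3) by simp
    qed
    \<comment> \<open>In the case \<open>shift\<close> the second part can drop by one: it stays at
      least \<open>m\<close> and no smaller than the later parts.\<close>
    consider (dup) zs where "ys = b # zs" | (short) "ys = []" "b = m"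
      | (shift) "m < b" "\<forall>y\<in>set ys. y < b"
    proof (cases ys)
      case Nil
      then show ?thesis
        using that xs 3 assms by (cases "b = m") (auto simp: in_ratio_partitions)
    next
      case (Cons c zs)
      then show ?thesis
        using that xs 3 assms by (cases "c = b") (fastforce simp: in_ratio_partitions)+
    qed
    then show ?thesis
    proof cases
      case dup
      then have "xs = duplicate_second ((a + b) # b # zs)"
        "(a + b) # b # zs \<in> ratio_partitions (Suc u) n m"
        using xs 3 assms by (auto simp: in_ratio_partitions)
      then show ?thesis by blast
    next
      case short
      then have "xs = raise_top m u [n - Suc u]"
        "[n - Suc u] \<in> ratio_partitions u (n - Suc u) m"
        using xs 3 assms step by (auto simp: in_ratio_partitions)
      then show ?thesis by blast
    next
      case shift
      then obtain c where b: "b = Suc c" by (cases b) auto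
      have "u * Suc c \<le> a" using xs 3 assms b by (simp add: in_ratio_partitions)
      \<comment> \<open>The bound \<open>u \<le> a\<close> makes the truncated \<open>a - u\<close>
        a true difference.\<close>
      then have a: "u * c \<le> a - u" "u \<le> a" by auto
      have "xs = raise_top m u ((a - u) # c # ys)"
        using 3 b a by simp
      moreover have "(a - u) # c # ys \<in> ratio_partitions u (n - Suc u) m"
        using xs 3 assms a b shift by (auto simp: in_ratio_partitions)
      ultimately show ?thesis by blast
    qed
  qed
qed

theorem theorem3:
  fixes n m t :: nat
  assumes "n > 0" and "m > 0" and "t > 0"
    and "n > t" and "t > 1"
    and "m \<le> n div (t + 1)"
  shows "int (part_count t n m) = int (part_count (t - 1) n m) - int (part_count (t - 1) (n - t) m)"
proof -
  \<comment> \<open>With u = t - 1, the assumption t > 1 gives the positive ratio that the lemmas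
    require.\<close>
  obtain u where t: "t = Suc u" using assms(3) by (cases t) auto
  have "m * (t + 1) \<le> n"
    using assms(6) by (simp add: less_eq_div_iff_mult_less_eq)
  then have hyps: "0 < u" "0 < m" "Suc (Suc u) * m \<le> n" "Suc u < n"
    using assms t by (simp_all add: algebra_simps)
  let ?D = "duplicate_second ` ratio_partitions (Suc u) n m"
  let ?R = "raise_top m u ` ratio_partitions u (n - Suc u) m"
  have "ratio_partitions u n m = ?D \<union> ?R"
    using ratio_partitions_subset_images[OF hyps] hyps
      duplicate_second_in_ratio_partitions raise_top_in_ratio_partitions by blast
  then have "card (ratio_partitions u n m) = card ?D + card ?R"
    using hyps by (simp add: card_Un_disjoint finite_ratio_partitions
        duplicate_second_raise_top_disjoint)
  then have "part_count u n m = part_count (Suc u) n m + part_count u (n - Suc u) m"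
    using hyps by (simp add: part_count_def card_image inj_on_duplicate_second inj_on_raise_top)
  then show ?thesis using t by simp
qed

end
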